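(* For all integers $n\geq 0$ and all integers $r$ with $1\leq r\leq 4$, $$DSOME(25n+5r+1)\equiv 0\pmod{4}.$$
   Context: For an integer $n\ge 0$, $DSOME(n)$ denotes the sum of all the odd parts in all the partitions of $n$ into distinct parts minus the sum of all the even parts in all the partitions of $n$ into distinct parts. That is, $DSOME(n)=\sum_{\lambda}\left(\sum_{\lambda_i \text{ odd}}\lambda_i-\sum_{\lambda_i\text{ even}}\lambda_i\right)$, where $\lambda$ runs over all partitions of $n$ into distinct parts and $\lambda_i$ runs over the parts of $\lambda$; in particular $DSOME(0)=0$. *)

theory Defs
  imports "HOL-Number_Theory.Cong"
begin

text \<open>A partition into distinct parts has no repeated parts, so it is the same thing as the finite
  set of its (positive) parts.\<close>

definition distinct_partitions :: "nat \<Rightarrow> nat set set" where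
  "distinct_partitions n = {P. finite P \<and> (\<forall>i\<in>P. i > 0) \<and> \<Sum>P = n}"

definition DSOME :: "nat \<Rightarrow> int" where
  "DSOME n = (\<Sum>P\<in>distinct_partitions n.
      (\<Sum>i | i \<in> P \<and> odd i. int i) - (\<Sum>i | i \<in> P \<and> even i. int i))"

text \<open>The outer sum really ranges over a finite set, so it is not zero by convention.\<close>

lemma finite_distinct_partitions: "finite (distinct_partitions n)"
proof (rule finite_subset)
  show "distinct_partitions n \<subseteq> Pow {..n}"
    by (auto simp: distinct_partitions_def intro: member_le_sum[of _ _ "\<lambda>x. x", simplified])
qed simp

lemma DSOME_0: "DSOME 0 = 0"
proof -
  have "distinct_partitions 0 = {{}}"
    by (fastforce simp: distinct_partitions_def)
  then show ?thesis
    by (simp add: DSOME_def)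
qed

end

theory Submission
  imports Defs "HOL-Computational_Algebra.Polynomial"
begin

text \<open>Subtracting the even parts instead of adding them changes a part sum by a multiple of 4, so
  \<open>DSOME n\<close> is congruent to \<open>n * Q n\<close> modulo 4, where \<open>Q n\<close> counts the partitions of \<open>n\<close> into
  distinct parts. Gauss's identity \<open>(\<Prod>k. (1 - q^k) / (1 + q^k)) = 1 + 2 * (\<Sum>m\<ge>1. (-1)^m * q^(m^2))\<close> and
  Euler's pentagonal number theorem give \<open>Q n + 2 * (\<Sum>m\<ge>1. (-1)^m * Q (n - m^2)) = e n\<close>, where \<open>e n\<close>
  is a sign if \<open>24 * n + 1\<close> is a square and 0 otherwise. Hence \<open>Q n\<close> is odd iff \<open>24 * n + 1\<close> is a square, and
  if \<open>N = 24 * n + 1\<close> is not a square, then modulo 4 the number \<open>Q n\<close> is twice the number of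
  representations \<open>N = x^2 + 24 * m^2\<close> with positive \<open>x\<close> and \<open>m\<close>. For the \<open>n\<close> in question 5 divides \<open>N\<close>
  exactly once, and multiplication by \<open>(1 - 2 * sqrt (-6)) / 5\<close> followed by conjugation pairs up these
  representations.\<close>

section \<open>Parity by fixed-point-free involutions\<close>

lemma even_card_involution:
  assumes "finite S" "\<And>x. x \<in> S \<Longrightarrow> f x \<in> S" "\<And>x. x \<in> S \<Longrightarrow> f (f x) = x"
    "\<And>x. x \<in> S \<Longrightarrow> f x \<noteq> x"
  shows "even (card S)"
  using assms
proof (induction "card S" arbitrary: S rule: less_induct)
  case less
  show ?case
  proof (cases "S = {}")
    case False
    then obtain x where x: "x \<in> S" by blast
    let ?T = "S - {x, f x}"
    have S: "S = insert x (insert (f x) ?T)" using x less.prems(2) by blast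
    have fT: "finite ?T" using less.prems(1) by blast
    have c: "card S = Suc (Suc (card ?T))"
      by (subst S) (use fT less.prems(4)[OF x] in auto)
    have "even (card ?T)"
    proof (rule less.hyps)
      show "f y \<in> ?T" if "y \<in> ?T" for y
        using that less.prems(2,3) x by (metis DiffD1 DiffD2 DiffI insertE insertI1 insertI2 singletonD)
    qed (use c fT less.prems in auto)
    then show ?thesis using c by simp
  qed simp
qed

section \<open>Finite q-series identities of Gauss and Euler\<close>

lemma qprod_Suc_upper:
  fixes q :: "'a::comm_ring_1"
  assumes "i \<le> n"
  shows "(\<Prod>k\<in>{i<..Suc n}. 1 - q ^ k) = (\<Prod>k\<in>{i<..n}. 1 - q ^ k) * (1 - q ^ Suc n)"
proof -
  have "{i<..Suc n} = insert (Suc n) {i<..n}" using assms by auto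
  then show ?thesis by (simp add: mult.commute)
qed

lemma qprod_Suc_lower:
  fixes q :: "'a::comm_ring_1"
  assumes "i < n"
  shows "(\<Prod>k\<in>{i<..n}. 1 - q ^ k) = (1 - q ^ Suc i) * (\<Prod>k\<in>{Suc i<..n}. 1 - q ^ k)"
proof -
  have "{i<..n} = insert (Suc i) {Suc i<..n}" using assms by auto
  then show ?thesis by simp
qed

text \<open>Shanks's finite forms of the identities of Gauss and Euler: modulo \<open>q ^ Suc n\<close> only the first
  product survives on the right-hand sides.\<close>

lemma Gauss_square_finite:
  fixes q :: "'a::comm_ring_1"
  shows "(\<Prod>k=1..n. 1 + q ^ k) * (1 + 2 * (\<Sum>m=1..n. (- 1) ^ m * q ^ m\<^sup>2)) =
    (\<Prod>k\<in>{0<..n}. 1 - q ^ k) +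
    2 * (\<Sum>i<n. (- 1) ^ Suc i * (\<Prod>k\<in>{Suc i<..n}. 1 - q ^ k) * (\<Prod>k=1..i. 1 + q ^ k) *
      q ^ (Suc i * Suc n))"
proof (induction n)
  case 0
  then show ?case by simp
next
  case (Suc n)
  define D where "D = (\<lambda>n i. \<Prod>k\<in>{i<..n}. 1 - q ^ k)"
  define E where "E = (\<lambda>n. \<Prod>k=1..n. 1 + q ^ k)"
  define t where "t = (\<lambda>n i. (- 1) ^ Suc i * D n (Suc i) * E i * q ^ (Suc i * Suc n))"
  \<comment> \<open>\<open>1 + r\<close> is the factor that \<open>E\<close> gains when
    \<open>n\<close> increases. \<open>u\<close> is chosen so that the difference between
    \<open>t (Suc n) i\<close> and \<open>(1 + r) * t n i\<close> telescopes in
    \<open>i\<close>.\<close>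
  define u where "u = (\<lambda>i. (- 1) ^ Suc i * D n i * E i * q ^ (Suc i * Suc n))"
  define G where "G = (\<Sum>m=1..n. (- 1) ^ m * q ^ m\<^sup>2)"
  define r where "r = q ^ Suc n"
  have IH: "E n * (1 + 2 * G) = D n 0 + 2 * (\<Sum>i<n. t n i)"
    using Suc unfolding D_def E_def t_def G_def by simp
  have E_Suc: "E (Suc i) = E i * (1 + q ^ Suc i)" for i
    unfolding E_def by simp
  have D_upper: "D (Suc n) i = D n i * (1 - r)" if "i \<le> n" for i
    using qprod_Suc_upper[OF that, of q] unfolding D_def r_def .
  have D_lower: "D n i = (1 - q ^ Suc i) * D n (Suc i)" if "i < n" for i
    using qprod_Suc_lower[OF that, of q] unfolding D_def .
  have D_self: "D i i = 1" for i
    unfolding D_def by simp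
  have pw: "q ^ (Suc i * Suc (Suc n)) = q ^ (Suc i * Suc n) * q ^ Suc i" for i
    by (subst power_add[symmetric]) (simp add: add_ac del: power_Suc)
  have pw': "q ^ (Suc (Suc i) * Suc n) = q ^ (Suc i * Suc n) * r" for i
    unfolding r_def by (subst power_add[symmetric]) (simp add: add_ac del: power_Suc)
  have step: "t (Suc n) i - (1 + r) * t n i = u (Suc i) - u i" if "i < n" for i
    unfolding t_def u_def E_Suc pw pw' D_upper[OF Suc_leI[OF that]] D_lower[OF that]
    by (simp add: algebra_simps)
  have "(\<Sum>i<n. t (Suc n) i) - (1 + r) * (\<Sum>i<n. t n i) = (\<Sum>i<n. u (Suc i) - u i)"
    unfolding sum_distrib_left sum_subtractf[symmetric] using step by (intro sum.cong) auto
  also have "\<dots> = u n - u 0"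
    by (rule sum_lessThan_telescope)
  finally have tel: "(\<Sum>i<n. t (Suc n) i) = (1 + r) * (\<Sum>i<n. t n i) + u n - u 0"
    by (simp add: algebra_simps)
  \<comment> \<open>The boundary terms do the work: \<open>u 0\<close> turns
    \<open>(1 + r) * D n 0\<close> into \<open>(1 - r) * D n 0 = D (Suc n) 0\<close>, and
    \<open>u n\<close> is \<open>E n\<close> times the new square term.\<close>
  have u0: "u 0 = - (D n 0 * r)"
    unfolding u_def E_def r_def by simp
  have tn: "t (Suc n) n = u n * r"
    unfolding t_def u_def D_self r_def pw by (simp add: mult.assoc)
  have un: "u n = E n * ((- 1) ^ Suc n * q ^ (Suc n)\<^sup>2)"
    unfolding u_def D_self power2_eq_square by (simp add: mult_ac)
  have "E (Suc n) * (1 + 2 * (G + (- 1) ^ Suc n * q ^ (Suc n)\<^sup>2)) =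
      (1 + r) * (E n * (1 + 2 * G)) + 2 * (1 + r) * u n"
    unfolding E_Suc un r_def[symmetric] by (simp add: algebra_simps)
  also have "\<dots> = D (Suc n) 0 + 2 * ((\<Sum>i<n. t (Suc n) i) + t (Suc n) n)"
    unfolding IH tel tn u0 D_upper[OF le0] by (simp add: algebra_simps)
  finally show ?case
    unfolding D_def E_def t_def G_def by simp
qed

lemma triangle_Suc: "Suc n * Suc (Suc n) div 2 = n * Suc n div 2 + Suc n"
proof -
  have "Suc n * Suc (Suc n) = n * Suc n + Suc n * 2" by simp
  then show ?thesis by simp
qed

lemma Euler_pentagonal_finite:
  fixes q :: "'a::comm_ring_1"
  shows "1 + (\<Sum>s=1..n. (- 1) ^ s * (q ^ (s * (s - 1) + s * Suc s div 2) + q ^ (s * s + s * Suc s div 2))) =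
    (\<Sum>s\<le>n. (- 1) ^ s * (\<Prod>k\<in>{s<..n}. 1 - q ^ k) * q ^ (s * n + s * Suc s div 2))"
proof (induction n)
  case 0
  then show ?case by simp
next
  case (Suc n)
  define D where "D = (\<lambda>n i. \<Prod>k\<in>{i<..n}. 1 - q ^ k)"
  define b where "b = (\<lambda>n s. (- 1) ^ s * D n s * q ^ (s * n + s * Suc s div 2))"
  \<comment> \<open>For \<open>s < n\<close>, passing to \<open>Suc n\<close> changes
    \<open>b n s\<close> by \<open>v (Suc s) - v s\<close>. At \<open>s = n\<close> the empty
    product \<open>D n n\<close> has no factor \<open>1 - q ^ Suc n\<close> to split off, and
    \<open>w\<close> takes the place of \<open>v (Suc n)\<close>.\<close>
  define v where "v = (\<lambda>s. (1 - q ^ s) * b n s)"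
  define w where "w = (- 1) ^ Suc n * q ^ (Suc n * n + Suc n * Suc (Suc n) div 2)"
  define r where "r = q ^ Suc n"
  have D_upper: "D (Suc n) i = D n i * (1 - r)" if "i \<le> n" for i
    using qprod_Suc_upper[OF that, of q] unfolding D_def r_def .
  have D_lower: "D n i = (1 - q ^ Suc i) * D n (Suc i)" if "i < n" for i
    using qprod_Suc_lower[OF that, of q] unfolding D_def .
  have D_self: "D i i = 1" for i
    unfolding D_def by simp
  have pw: "q ^ (s * Suc n + c) = q ^ (s * n + c) * q ^ s" for s c
    by (simp add: power_add[symmetric] algebra_simps)
  have bb: "b (Suc n) s - b n s = - v s - q ^ s * r * b n s" if "s \<le> n" for s
    unfolding b_def v_def D_upper[OF that] pw by (simp add: algebra_simps)
  have pw': "q ^ (Suc s * n + (s * Suc s div 2 + Suc s)) = q ^ (s * n + s * Suc s div 2) * (q ^ s * r)" for s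
    by (simp only: r_def power_add[symmetric], rule arg_cong[of _ _ "(^) q"]) simp
  have vS: "v (Suc s) = - (q ^ s * r * b n s)" if "s < n" for s
    unfolding v_def b_def triangle_Suc pw' D_lower[OF that] by (simp add: algebra_simps)
  have w: "w = - (q ^ n * r * b n n)"
    unfolding w_def b_def triangle_Suc pw' D_self by (simp add: algebra_simps)
  have "(\<Sum>s<n. b (Suc n) s - b n s) = (\<Sum>s<n. v (Suc s) - v s)"
    by (intro sum.cong refl) (simp add: bb vS)
  also have "\<dots> = v n - v 0"
    by (rule sum_lessThan_telescope)
  also have "v 0 = 0" unfolding v_def by simp
  finally have tel: "(\<Sum>s<n. b (Suc n) s) = (\<Sum>s<n. b n s) + v n"
    by (simp add: sum_subtractf algebra_simps)
  have "(\<Sum>s\<le>Suc n. b (Suc n) s) = (\<Sum>s<n. b (Suc n) s) + b (Suc n) n + b (Suc n) (Suc n)"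
    by (simp add: lessThan_Suc_atMost[symmetric])
  also have "b (Suc n) n = b n n - v n + w"
    using bb[of n] unfolding w by (simp add: algebra_simps)
  finally have "(\<Sum>s\<le>Suc n. b (Suc n) s) = (\<Sum>s\<le>n. b n s) + w + b (Suc n) (Suc n)"
    unfolding tel by (simp add: lessThan_Suc_atMost[symmetric])
  \<comment> \<open>The two pentagonal terms of index \<open>Suc n\<close>: \<open>w\<close> has the
    smaller exponent, \<open>b (Suc n) (Suc n)\<close> the larger.\<close>
  moreover have "w + b (Suc n) (Suc n) = (- 1) ^ Suc n * (q ^ (Suc n * (Suc n - 1) + Suc n * Suc (Suc n) div 2)
      + q ^ (Suc n * Suc n + Suc n * Suc (Suc n) div 2))"
    unfolding w_def b_def D_self distrib_left mult_1_right diff_Suc_1 ..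
  moreover have "1 + (\<Sum>s=1..n. (- 1) ^ s * (q ^ (s * (s - 1) + s * Suc s div 2) + q ^ (s * s + s * Suc s div 2)))
      = (\<Sum>s\<le>n. b n s)"
    using Suc unfolding b_def D_def .
  ultimately have "1 + (\<Sum>s=1..Suc n. (- 1) ^ s * (q ^ (s * (s - 1) + s * Suc s div 2) + q ^ (s * s + s * Suc s div 2)))
      = (\<Sum>s\<le>Suc n. b (Suc n) s)"
    by (subst sum.cl_ivl_Suc) (simp only: add.assoc if_False not_less_eq_eq le0 Suc_leI One_nat_def, simp)
  then show ?case
    unfolding b_def D_def .
qed

section \<open>Coefficients of the two products\<close>

lemma prod_one_plus_power:
  fixes q :: "'a::comm_semiring_1"
  assumes "finite A"
  shows "(\<Prod>k\<in>A. 1 + q ^ k) = (\<Sum>P\<in>Pow A. q ^ \<Sum>P)"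
  unfolding add.commute[of 1] prod_add[OF assms] by (simp add: power_sum)

text \<open>Parts of a partition of \<open>n\<close> are at most \<open>n\<close>, so truncating the
  product at \<open>M\<close> loses nothing. \<open>M\<close> is separate from \<open>n\<close>
  because the recurrence reads the coefficients at all \<open>n - m\<^sup>2\<close> off one
  product.\<close>

lemma coeff_prod_one_plus_monom:
  assumes "n \<le> M"
  shows "coeff (\<Prod>k=1..M. 1 + monom (1::int) 1 ^ k) n = int (card (distinct_partitions n))"
proof -
  have "distinct_partitions n = {P \<in> Pow {1..M}. \<Sum>P = n}"
  proof (intro equalityI subsetI)
    fix P assume P: "P \<in> distinct_partitions n"
    have "i \<le> \<Sum>P" if "i \<in> P" for i
      using that P by (intro member_le_sum[of _ _ "\<lambda>x. x"]) (auto simp: distinct_partitions_def)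
    then show "P \<in> {P \<in> Pow {1..M}. \<Sum>P = n}"
      using P assms by (fastforce simp: distinct_partitions_def Suc_le_eq)
  next
    fix P assume "P \<in> {P \<in> Pow {1..M}. \<Sum>P = n}"
    then show "P \<in> distinct_partitions n"
      by (auto simp: distinct_partitions_def intro: finite_subset)
  qed
  moreover have "finite (Pow {1..M})" by simp
  ultimately show ?thesis
    unfolding prod_one_plus_power[OF finite_atLeastAtMost] unfolding monom_power coeff_sum
    by (simp add: sum.If_cases Int_def)
qed

text \<open>Completing the square: the exponents are the generalized pentagonal numbers
  \<open>s * (3 * s - 1) / 2\<close> and \<open>s * (3 * s + 1) / 2\<close>, written with a
  triangular number so that only \<open>s * Suc s\<close> is halved.\<close>

lemma pentagonal_24:
  fixes s :: nat
  assumes "s \<ge> 1"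
  shows "24 * (s * (s - 1) + s * Suc s div 2) + 1 = (6 * s - 1)\<^sup>2"
    and "24 * (s * s + s * Suc s div 2) + 1 = (6 * s + 1)\<^sup>2"
proof -
  define c where "c = s * Suc s div 2"
  have c: "2 * c = s * Suc s" unfolding c_def by simp
  obtain k where k: "s = Suc k" using assms by (cases s) auto
  have "24 * (s * (s - 1) + c) + 1 = 24 * (s * (s - 1)) + 12 * (2 * c) + 1" by simp
  also have "\<dots> = (6 * s - 1)\<^sup>2" unfolding c k by (simp add: power2_eq_square algebra_simps)
  finally show "24 * (s * (s - 1) + s * Suc s div 2) + 1 = (6 * s - 1)\<^sup>2" unfolding c_def .
  have "24 * (s * s + c) + 1 = 24 * (s * s) + 12 * (2 * c) + 1" by simp
  also have "\<dots> = (6 * s + 1)\<^sup>2" unfolding c by (simp add: power2_eq_square algebra_simps)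
  finally show "24 * (s * s + s * Suc s div 2) + 1 = (6 * s + 1)\<^sup>2" unfolding c_def .
qed

lemma minus_one_power_mult_poly:
  fixes p :: "'a::comm_ring_1 poly"
  shows "(- 1) ^ m * p = smult ((- 1) ^ m) p"
  by (cases "even m") simp_all

lemma monom_dvd_imp_coeff_eq:
  assumes "monom (1::int) 1 ^ Suc n dvd p - p'"
  shows "coeff p n = coeff p' n"
  using assms unfolding monom_power by (simp add: monom_1_dvd_iff')

text \<open>In Euler's finite identity the summand \<open>s = 0\<close> is the product itself, and
  every later one is divisible by \<open>X ^ Suc n\<close>.\<close>

lemma coeff_Euler_product:
  "coeff (\<Prod>k\<in>{0<..n}. 1 - monom (1::int) 1 ^ k) n =
    (if n = 0 then 1 else 0) + (\<Sum>s=1..n. (- 1) ^ s *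
      ((if 24 * n + 1 = (6 * s - 1)\<^sup>2 then 1 else 0) + (if 24 * n + 1 = (6 * s + 1)\<^sup>2 then 1 else 0)))"
proof -
  define X where "X = monom (1::int) 1"
  define L where "L = 1 + (\<Sum>s=1..n. (- 1) ^ s * (X ^ (s * (s - 1) + s * Suc s div 2) + X ^ (s * s + s * Suc s div 2)))"
  have "L - (\<Prod>k\<in>{0<..n}. 1 - X ^ k) =
      (\<Sum>s\<in>{..n} - {0}. (- 1) ^ s * (\<Prod>k\<in>{s<..n}. 1 - X ^ k) * X ^ (s * n + s * Suc s div 2))"
    unfolding L_def Euler_pentagonal_finite by (subst sum.remove[of _ 0]) auto
  moreover have "X ^ Suc n dvd \<dots>"
  proof (intro dvd_sum dvd_mult le_imp_power_dvd)
    fix s assume "s \<in> {..n} - {0}"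
    then obtain k where k: "s = Suc k" by (cases s) auto
    show "Suc n \<le> s * n + s * Suc s div 2"
      unfolding k triangle_Suc by simp
  qed
  ultimately have "coeff (\<Prod>k\<in>{0<..n}. 1 - X ^ k) n = coeff L n"
    unfolding X_def by (intro monom_dvd_imp_coeff_eq[symmetric]) simp
  also have "coeff L n = (if n = 0 then 1 else 0) + (\<Sum>s=1..n. coeff ((- 1) ^ s *
      (X ^ (s * (s - 1) + s * Suc s div 2) + X ^ (s * s + s * Suc s div 2))) n)"
    unfolding L_def by (simp add: coeff_sum)
  also have "coeff ((- 1) ^ s * (X ^ (s * (s - 1) + s * Suc s div 2) + X ^ (s * s + s * Suc s div 2))) n =
      (- 1) ^ s * ((if 24 * n + 1 = (6 * s - 1)\<^sup>2 then 1 else 0) + (if 24 * n + 1 = (6 * s + 1)\<^sup>2 then 1 else 0))"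
    if "s \<in> {1..n}" for s
  proof -
    have "s \<ge> 1" using that by simp
    have "s * (s - 1) + s * Suc s div 2 = n \<longleftrightarrow> 24 * n + 1 = (6 * s - 1)\<^sup>2"
      "s * s + s * Suc s div 2 = n \<longleftrightarrow> 24 * n + 1 = (6 * s + 1)\<^sup>2"
      unfolding pentagonal_24[OF \<open>s \<ge> 1\<close>, symmetric] by auto
    then show ?thesis
      unfolding X_def monom_power minus_one_power_mult_poly by simp
  qed
  then have "(\<Sum>s=1..n. coeff ((- 1) ^ s * (X ^ (s * (s - 1) + s * Suc s div 2) + X ^ (s * s + s * Suc s div 2))) n) =
    (\<Sum>s=1..n. (- 1) ^ s * ((if 24 * n + 1 = (6 * s - 1)\<^sup>2 then 1 else 0) + (if 24 * n + 1 = (6 * s + 1)\<^sup>2 then 1 else 0)))"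
    by (intro sum.cong) auto
  finally show ?thesis unfolding X_def .
qed

lemma coeff_Euler_product_eq_0:
  assumes "\<nexists>x. 24 * n + 1 = x\<^sup>2"
  shows "coeff (\<Prod>k\<in>{0<..n}. 1 - monom (1::int) 1 ^ k) n = 0"
proof -
  have "n \<noteq> 0" using assms by (metis mult_0_right add_0 one_power2)
  then show ?thesis using assms unfolding coeff_Euler_product by auto
qed

text \<open>Being prime to 6, \<open>x\<close> equals \<open>6 * s - 1\<close> or
  \<open>6 * s + 1\<close> for exactly one \<open>s\<close>, so a single sign survives.\<close>

lemma odd_coeff_Euler_product:
  assumes x: "24 * n + 1 = x\<^sup>2"
  shows "odd (coeff (\<Prod>k\<in>{0<..n}. 1 - monom (1::int) 1 ^ k) n)"
proof (cases "n = 0")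
  case False
  have "odd (x\<^sup>2)" "\<not> 3 dvd x\<^sup>2" unfolding x[symmetric] by presburger+
  then have "odd x" "\<not> 3 dvd x" by (auto simp: power2_eq_square)
  then have "x mod 6 = 1 \<or> x mod 6 = 5" by presburger
  \<comment> \<open>\<open>x = 1\<close> would give \<open>s = 0\<close>, which is the constant term
    outside the sum.\<close>
  moreover have "x \<noteq> 1" using x False by auto
  ultimately obtain s where s: "s \<ge> 1" "x = 6 * s - 1 \<or> x = 6 * s + 1"
  proof (elim disjE, goal_cases)
    case 1
    then show ?case by (intro 1(1)[of "x div 6"]) presburger+
  next
    case 2
    then show ?case by (intro 2(1)[of "x div 6 + 1"]) presburger+
  qed
  have "s \<le> s * s" using s(1) by simp
  \<comment> \<open>The index must lie in the range of the truncated sum: a pentagonal number of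
    index \<open>s\<close> is at least \<open>s\<close>.\<close>
  have "24 * s + 1 \<le> 24 * n + 1"
    using s(2)
  proof
    assume "x = 6 * s - 1"
    then have "24 * n + 1 = 24 * (s * (s - 1) + s * Suc s div 2) + 1"
      unfolding pentagonal_24[OF s(1)] x by simp
    moreover obtain k where "s = Suc k" using s(1) by (cases s) auto
    ultimately show ?thesis unfolding triangle_Suc by (simp add: triangle_Suc)
  next
    assume "x = 6 * s + 1"
    then have "24 * n + 1 = 24 * (s * s + s * Suc s div 2) + 1"
      unfolding pentagonal_24[OF s(1)] x by simp
    then have "n = s * s + s * Suc s div 2" by (simp only: add_right_cancel mult_cancel1) simp
    then have "s \<le> n" using \<open>s \<le> s * s\<close> by (simp only: trans_le_add1)
    then show ?thesis by simp
  qed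
  then have sn: "s \<in> {1..n}" using s(1) by simp
  have "(\<Sum>k=1..n. (- 1) ^ k *
      ((if 24 * n + 1 = (6 * k - 1)\<^sup>2 then 1 else 0) + (if 24 * n + 1 = (6 * k + 1)\<^sup>2 then 1 else 0)))
      = (\<Sum>k=1..n. if k = s then (- 1 :: int) ^ k else 0)"
  proof (intro sum.cong refl)
    fix k assume "k \<in> {1..n}"
    then have "1 \<le> k" by simp
    have "6 * s - 1 = 6 * k - 1 \<longleftrightarrow> k = s" "6 * s + 1 = 6 * k + 1 \<longleftrightarrow> k = s"
      "6 * s - 1 \<noteq> 6 * k + 1" "6 * s + 1 \<noteq> 6 * k - 1"
      using s(1) \<open>1 \<le> k\<close> by presburger+
    then show "(- 1) ^ k * ((if 24 * n + 1 = (6 * k - 1)\<^sup>2 then 1 else 0) +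
        (if 24 * n + 1 = (6 * k + 1)\<^sup>2 then 1 else 0)) = (if k = s then (- 1 :: int) ^ k else 0)"
      unfolding x power2_eq_iff_nonneg[OF le0 le0] using s(2) by (elim disjE) simp_all
  qed
  also have "\<dots> = (- 1) ^ s" using sn by simp
  finally show ?thesis unfolding coeff_Euler_product using False by simp
qed (simp add: coeff_Euler_product)

section \<open>Recurrence and parity for the number of partitions into distinct parts\<close>

text \<open>Compare coefficients at \<open>n\<close> in Gauss's finite identity: its correction
  terms carry \<open>X ^ (Suc i * Suc n)\<close> and vanish there.\<close>

lemma card_distinct_partitions_recurrence:
  "int (card (distinct_partitions n)) +
      2 * (\<Sum>m | 1 \<le> m \<and> m\<^sup>2 \<le> n. (- 1) ^ m * int (card (distinct_partitions (n - m\<^sup>2)))) =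
    coeff (\<Prod>k\<in>{0<..n}. 1 - monom (1::int) 1 ^ k) n"
proof -
  define X where "X = monom (1::int) 1"
  define E where "E = (\<Prod>k=1..n. 1 + X ^ k)"
  have "X ^ Suc n dvd E * (1 + 2 * (\<Sum>m=1..n. (- 1) ^ m * X ^ m\<^sup>2)) - (\<Prod>k\<in>{0<..n}. 1 - X ^ k)"
    unfolding E_def Gauss_square_finite add_diff_cancel_left'
    by (intro dvd_mult dvd_sum le_imp_power_dvd) simp
  then have "coeff (\<Prod>k\<in>{0<..n}. 1 - X ^ k) n = coeff (E * (1 + 2 * (\<Sum>m=1..n. (- 1) ^ m * X ^ m\<^sup>2))) n"
    unfolding X_def by (intro monom_dvd_imp_coeff_eq[symmetric])
  also have "E * (1 + 2 * (\<Sum>m=1..n. (- 1) ^ m * X ^ m\<^sup>2)) =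
      E + smult 2 (\<Sum>m=1..n. smult ((- 1) ^ m) (X ^ m\<^sup>2 * E))"
  proof -
    have "smult ((- 1) ^ m) (X ^ m\<^sup>2 * E) = E * ((- 1) ^ m * X ^ m\<^sup>2)" for m
      unfolding minus_one_power_mult_poly[symmetric] by (simp only: mult_ac)
    moreover have "smult 2 p = 2 * p" for p :: "int poly"
      by (simp add: numeral_poly)
    ultimately show ?thesis
      by (simp only: distrib_left sum_distrib_left mult_1_right mult.left_commute[of E 2])
  qed
  also have "coeff \<dots> n = coeff E n + 2 * (\<Sum>m=1..n. (- 1) ^ m * coeff (X ^ m\<^sup>2 * E) n)"
    by (simp add: coeff_sum)
  also have "(\<Sum>m=1..n. (- 1) ^ m * coeff (X ^ m\<^sup>2 * E) n) =
      (\<Sum>m=1..n. if m\<^sup>2 \<le> n then (- 1) ^ m * int (card (distinct_partitions (n - m\<^sup>2))) else 0)"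
    using coeff_prod_one_plus_monom[of _ n]
    by (intro sum.cong refl) (auto simp: X_def E_def monom_power coeff_monom_mult)
  also have "\<dots> = (\<Sum>m | m \<in> {1..n} \<and> m\<^sup>2 \<le> n. (- 1) ^ m * int (card (distinct_partitions (n - m\<^sup>2))))"
    by (rule sum.inter_filter[symmetric]) simp
  also have "{m. m \<in> {1..n} \<and> m\<^sup>2 \<le> n} = {m. 1 \<le> m \<and> m\<^sup>2 \<le> n}"
    by (auto dest: power2_nat_le_imp_le)
  also have "coeff E n = int (card (distinct_partitions n))"
    unfolding E_def X_def by (rule coeff_prod_one_plus_monom) simp
  finally show ?thesis unfolding X_def by simp
qed

text \<open>Modulo 2 the sum over squares drops out of the recurrence, leaving the pentagonal
  coefficient.\<close>

lemma odd_card_distinct_partitions_iff: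
  "odd (card (distinct_partitions n)) \<longleftrightarrow> (\<exists>x. 24 * n + 1 = x\<^sup>2)"
proof -
  have "odd (int (card (distinct_partitions n))) \<longleftrightarrow>
      odd (coeff (\<Prod>k\<in>{0<..n}. 1 - monom (1::int) 1 ^ k) n)"
    unfolding card_distinct_partitions_recurrence[symmetric] by simp
  then show ?thesis
    using odd_coeff_Euler_product coeff_Euler_product_eq_0 by (metis even_of_nat even_zero)
qed

section \<open>Representations by the form x^2 + 24 m^2\<close>

lemma even_card_representations:
  fixes N :: int
  assumes "5 dvd N" "\<not> 25 dvd N" "odd N"
  shows "even (card {m::nat. 1 \<le> m \<and> (\<exists>x. x\<^sup>2 + 24 * (int m)\<^sup>2 = N)})" (is "even (card ?M)")
proof -
  \<comment> \<open>Fixing the sign of \<open>y\<close> by \<open>5 dvd y - m\<close> selects the prime above 5 in \<open>\<int>[sqrt (-6)]\<close> that divides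
    \<open>y + 2 * m * sqrt (-6)\<close>; both primes are non-principal, but their quotient is generated by
    \<open>(1 - 2 * sqrt (-6)) / 5\<close>.\<close>
  define S where "S = {(y, m). m > 0 \<and> y\<^sup>2 + 24 * m\<^sup>2 = N \<and> 5 dvd y - m}"
  \<comment> \<open>Multiplication and conjugation send \<open>(y, m)\<close> to
    \<open>((y + 24 * m) div 5, (y - m) div 5)\<close>; the common sign is then adjusted to make the
    second entry positive.\<close>
  define f :: "int \<times> int \<Rightarrow> int \<times> int" where
    "f = (\<lambda>(y, m). (sgn (y - m) * ((y + 24 * m) div 5), \<bar>(y - m) div 5\<bar>))"
  have not5: "\<not> 5 dvd m" if "y\<^sup>2 + 24 * m\<^sup>2 = N" "5 dvd y - m" for y m :: int
  proof
    assume "5 dvd m"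
    then have "5 dvd y" using that(2) by presburger
    then obtain a b where "y = 5 * a" "m = 5 * b" using \<open>5 dvd m\<close> by (auto elim!: dvdE)
    then have "N = 25 * (a\<^sup>2 + 24 * b\<^sup>2)" using that(1) by (simp add: power2_eq_square algebra_simps)
    then show False using assms(2) by simp
  qed
  have f: "f v \<in> S \<and> f (f v) = v \<and> f v \<noteq> v" if "v \<in> S" for v
  proof -
    obtain y m where v: "v = (y, m)" by (cases v)
    have m: "m > 0" and N: "y\<^sup>2 + 24 * m\<^sup>2 = N" and d: "5 dvd y - m"
      using that unfolding S_def v by auto
    obtain b where b: "y = m + 5 * b" using d by (metis dvdE add_diff_cancel_left' diff_add_cancel add.commute)
    \<comment> \<open>\<open>\<bar>b\<bar>\<close> is the new second entry and has to be
      positive.\<close>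
    have "b \<noteq> 0"
    proof
      assume "b = 0"
      then have "N = 25 * m\<^sup>2" using N b by simp
      then show False using assms(2) by simp
    qed
    have dv: "(y + 24 * m) div 5 = 5 * m + b" "(y - m) div 5 = b" unfolding b by simp_all
    have fv: "f v = (sgn b * (5 * m + b), \<bar>b\<bar>)"
      unfolding f_def v prod.case dv unfolding b by (simp add: sgn_mult)
    have N': "N = 25 * m\<^sup>2 + 10 * m * b + 25 * b\<^sup>2"
      unfolding N[symmetric] b by (simp add: power2_eq_square algebra_simps)
    \<comment> \<open>Excludes fixed points: these would need \<open>b = m\<close> or
      \<open>b = - m\<close>, hence \<open>y = 6 * m\<close> or \<open>y = - 4 * m\<close>.\<close>
    have "odd y" using N assms(3) by auto
    show ?thesis
    proof (cases "b > 0")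
      case True
      have "f v = (5 * m + b, b)" using fv True by simp
      moreover have "f (5 * m + b, b) = v"
        unfolding f_def v b using m by (simp add: sgn_mult)
      moreover have "(5 * m + b, b) \<in> S"
        unfolding S_def using True N' by (simp add: power2_eq_square algebra_simps)
      moreover have "(5 * m + b, b) \<noteq> v"
        using \<open>odd y\<close> unfolding v b by auto
      ultimately show ?thesis by simp
    next
      case False
      then have "b < 0" using \<open>b \<noteq> 0\<close> by simp
      have "f v = (- (5 * m + b), - b)" using fv \<open>b < 0\<close> by simp
      moreover have "- (25 * b) div 5 = - (5 * b)" "- (5 * m) div 5 = - m" by presburger+
      then have "f (- (5 * m + b), - b) = v"
        unfolding f_def v b using m by (simp add: sgn_mult)
      moreover have "(- (5 * m + b), - b) \<in> S"
        unfolding S_def using \<open>b < 0\<close> N' by (simp add: power2_eq_square algebra_simps)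
      moreover have "(- (5 * m + b), - b) \<noteq> v"
        using \<open>odd y\<close> unfolding v b prod.inject by presburger
      ultimately show ?thesis by simp
    qed
  qed
  \<comment> \<open>Each \<open>m\<close> is counted once: if \<open>y\<close> and
    \<open>- y\<close> both satisfied the congruence, 5 would divide \<open>2 * m\<close>, against
    \<open>not5\<close>.\<close>
  have inj: "inj_on snd S"
  proof (rule inj_onI)
    fix u v assume "u \<in> S" "v \<in> S" "snd u = snd v"
    then obtain y z m where uv: "u = (y, m)" "v = (z, m)" and
      h: "y\<^sup>2 + 24 * m\<^sup>2 = N" "z\<^sup>2 + 24 * m\<^sup>2 = N" "5 dvd y - m" "5 dvd z - m"
      unfolding S_def by auto
    from h(1,2) have "y = z \<or> y = - z" by (simp add: power2_eq_iff[symmetric])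
    moreover have "y \<noteq> - z" using h(3,4) not5[OF h(1) h(3)] by presburger
    ultimately show "u = v" using uv by simp
  qed
  have "snd ` S = int ` ?M"
  proof (intro equalityI subsetI)
    fix m assume "m \<in> snd ` S"
    then show "m \<in> int ` ?M"
      unfolding S_def by (auto intro!: image_eqI[of _ _ "nat m"])
  next
    fix k assume "k \<in> int ` ?M"
    then obtain x m where k: "k = int m" "k > 0" and x: "x\<^sup>2 + 24 * k\<^sup>2 = N" by auto
    \<comment> \<open>Shows that one of the two signs of \<open>x\<close> meets the congruence in
      \<open>S\<close>.\<close>
    have "(x - k) * (x + k) = N - 25 * k\<^sup>2"
      unfolding x[symmetric] by (simp add: power2_eq_square algebra_simps)
    also have "5 dvd \<dots>" using assms(1) by simp
    finally have "5 dvd x - k \<or> 5 dvd x + k"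
      by (subst (asm) prime_dvd_mult_iff) auto
    then have "5 dvd x - k \<or> 5 dvd - x - k" by presburger
    then have "(x, k) \<in> S \<or> (- x, k) \<in> S"
      unfolding S_def using k(2) x by auto
    then show "k \<in> snd ` S" by force
  qed
  then have card: "card ?M = card S"
    using card_image[OF inj] by (simp add: card_image)
  have "finite S"
  proof (cases "finite (snd ` S)")
    case False
    have "m \<in> {0..N}" if "m \<in> snd ` S" for m
    proof -
      have "m > 0" "24 * m\<^sup>2 \<le> N" using that unfolding S_def by auto
      moreover have "m \<le> m\<^sup>2" using \<open>m > 0\<close> by (simp add: power2_eq_square)
      ultimately show ?thesis by simp
    qed
    then show ?thesis using False finite_subset[of "snd ` S" "{0..N}"] by blast
  qed (use inj finite_imageD in blast)
  then have "even (card S)"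
    using f by (intro even_card_involution[of S f]) auto
  then show ?thesis using card by simp
qed

section \<open>\<open>DSOME\<close> modulo 4 and the final divisibility\<close>

lemma DSOME_cong_4: "[DSOME n = int n * int (card (distinct_partitions n))] (mod 4)"
proof -
  have "4 dvd (\<Sum>i | i \<in> P \<and> odd i. int i) - (\<Sum>i | i \<in> P \<and> even i. int i) - int n"
    if "P \<in> distinct_partitions n" for P
  proof -
    have P: "finite P" "\<Sum>P = n" using that by (auto simp: distinct_partitions_def)
    have "int n = (\<Sum>i\<in>{i. i \<in> P \<and> odd i} \<union> {i. i \<in> P \<and> even i}. int i)"
      unfolding P(2)[symmetric] of_nat_sum by (intro sum.cong) auto
    also have "\<dots> = (\<Sum>i | i \<in> P \<and> odd i. int i) + (\<Sum>i | i \<in> P \<and> even i. int i)"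
      using P(1) by (intro sum.union_disjoint) auto
    finally have "(\<Sum>i | i \<in> P \<and> odd i. int i) - (\<Sum>i | i \<in> P \<and> even i. int i) - int n =
        - (2 * (\<Sum>i | i \<in> P \<and> even i. int i))" by simp
    moreover have "even (\<Sum>i | i \<in> P \<and> even i. int i)" by (intro dvd_sum) auto
    then have "4 dvd - (2 * (\<Sum>i | i \<in> P \<and> even i. int i))" by presburger
    ultimately show ?thesis by (simp only:)
  qed
  then have "4 dvd (\<Sum>P\<in>distinct_partitions n.
      (\<Sum>i | i \<in> P \<and> odd i. int i) - (\<Sum>i | i \<in> P \<and> even i. int i) - int n)"
    by (intro dvd_sum)
  then show ?thesis
    unfolding DSOME_def cong_iff_dvd_diff by (simp add: sum_subtractf mult.commute)
qed

text \<open>A number divisible by 5 exactly once is not a square, so the recurrence has right-hand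
  side 0 and it suffices that its sum over squares is even.\<close>

lemma four_dvd_card_distinct_partitions:
  assumes "5 dvd 24 * n + 1" "\<not> 25 dvd 24 * n + 1"
  shows "4 dvd card (distinct_partitions n)"
proof -
  define Q where "Q = (\<lambda>n. card (distinct_partitions n))"
  define A where "A = {m. 1 \<le> m \<and> m\<^sup>2 \<le> n}"
  have "\<nexists>x. 24 * n + 1 = x\<^sup>2"
  proof
    assume "\<exists>x. 24 * n + 1 = x\<^sup>2"
    then obtain x where x: "24 * n + 1 = x\<^sup>2" by blast
    then have "5 dvd x" using assms(1) prime_dvd_power[of "5::nat"] by simp
    then have "5\<^sup>2 dvd x\<^sup>2" by (rule dvd_power_same)
    then show False using assms(2) x by simp
  qed
  then have eq: "int (Q n) + 2 * (\<Sum>m\<in>A. (- 1) ^ m * int (Q (n - m\<^sup>2))) = 0"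
    using card_distinct_partitions_recurrence[of n] coeff_Euler_product_eq_0[of n]
    unfolding Q_def A_def by simp
  have fin: "finite A"
  proof (rule finite_subset)
    show "A \<subseteq> {..n}" unfolding A_def by (auto dest: power2_nat_le_imp_le)
  qed simp
  \<comment> \<open>The odd summands are those where \<open>24 * (n - m\<^sup>2) + 1\<close> is a
    square \<open>x\<^sup>2\<close>, that is, the representations of
    \<open>24 * n + 1\<close>.\<close>
  have "{m \<in> A. odd ((- 1) ^ m * int (Q (n - m\<^sup>2)))} =
      {m. 1 \<le> m \<and> (\<exists>x. x\<^sup>2 + 24 * (int m)\<^sup>2 = int (24 * n + 1))}"
  proof (intro Collect_cong iffI; elim conjE)
    fix m assume "m \<in> A" "odd ((- 1) ^ m * int (Q (n - m\<^sup>2)))"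
    then obtain x where m: "1 \<le> m" "m\<^sup>2 \<le> n" and x: "24 * (n - m\<^sup>2) + 1 = x\<^sup>2"
      unfolding A_def Q_def using odd_card_distinct_partitions_iff by auto
    from x m have "x\<^sup>2 + 24 * m\<^sup>2 = 24 * n + 1" by simp
    then have "(int x)\<^sup>2 + 24 * (int m)\<^sup>2 = int (24 * n + 1)"
      by (metis of_nat_add of_nat_mult of_nat_numeral of_nat_power)
    with m show "1 \<le> m \<and> (\<exists>x. x\<^sup>2 + 24 * (int m)\<^sup>2 = int (24 * n + 1))" by blast
  next
    fix m assume m: "1 \<le> m" and "\<exists>x. x\<^sup>2 + 24 * (int m)\<^sup>2 = int (24 * n + 1)"
    then obtain x :: int where "x\<^sup>2 + 24 * (int m)\<^sup>2 = int (24 * n + 1)" by blast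
    then have "int ((nat \<bar>x\<bar>)\<^sup>2 + 24 * m\<^sup>2) = int (24 * n + 1)" by simp
    then have x: "(nat \<bar>x\<bar>)\<^sup>2 + 24 * m\<^sup>2 = 24 * n + 1" by (rule of_nat_eq_iff[THEN iffD1])
    then have mn: "m\<^sup>2 \<le> n" by linarith
    then have "24 * (n - m\<^sup>2) + 1 = (nat \<bar>x\<bar>)\<^sup>2" using x by simp
    then have "odd (Q (n - m\<^sup>2))" unfolding Q_def odd_card_distinct_partitions_iff by blast
    then show "m \<in> A \<and> odd ((- 1) ^ m * int (Q (n - m\<^sup>2)))" using m mn unfolding A_def by simp
  qed
  moreover have "even (card {m. 1 \<le> m \<and> (\<exists>x. x\<^sup>2 + 24 * (int m)\<^sup>2 = int (24 * n + 1))})"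
  proof (rule even_card_representations)
    show "5 dvd int (24 * n + 1)" "\<not> 25 dvd int (24 * n + 1)"
      using assms by (metis int_dvd_int_iff of_nat_numeral)+
  qed simp
  ultimately have "even (\<Sum>m\<in>A. (- 1) ^ m * int (Q (n - m\<^sup>2)))"
    unfolding even_sum_iff[OF fin] by simp
  then have "4 dvd int (Q n)" using eq by presburger
  then show ?thesis unfolding Q_def by presburger
qed

theorem theorem1p2:
  fixes n r :: nat
  assumes "1 \<le> r" and "r \<le> 4"
  shows "[DSOME (25 * n + 5 * r + 1) = 0] (mod 4)"
proof -
  let ?n = "25 * n + 5 * r + 1"
  \<comment> \<open>Modulo 25 only \<open>20 * r\<close> remains; it is a multiple of 5, and of 25
    only if 5 divides \<open>r\<close>.\<close>
  have eq: "24 * ?n + 1 = 25 * (24 * n + 4 * r + 1) + 20 * r" by simp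
  have "r \<in> {1, 2, 3, 4}" using assms by auto
  then have "\<not> 25 dvd 20 * r" by auto
  then have "\<not> 25 dvd 24 * ?n + 1"
    unfolding eq by (subst dvd_add_right_iff) simp_all
  moreover have "5 dvd 24 * ?n + 1"
    unfolding eq by (intro dvd_add dvd_mult2) simp_all
  ultimately have "4 dvd card (distinct_partitions ?n)"
    by (intro four_dvd_card_distinct_partitions)
  then have "[int ?n * int (card (distinct_partitions ?n)) = 0] (mod 4)"
    unfolding cong_0_iff by (metis dvd_mult int_dvd_int_iff of_nat_numeral)
  with DSOME_cong_4 show ?thesis by (rule cong_trans)
qed

end
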